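(* Given $\varphi\in[0,\pi)$, let $\alpha=\alpha(t)$, $t\in I_1$, and $\omega=\omega(s)$, $s\in I_2$, be unit speed planar curves whose curvature vectors satisfy $$\overrightarrow{\kappa_\alpha}=-\cos\varphi\,\alpha^\perp+\sin\varphi\,(J\alpha)^\perp,\qquad \overrightarrow{\kappa_\omega}=\cos\varphi\,\omega^\perp-\sin\varphi\,(J\omega)^\perp,$$ where $\perp$ denotes normal component and $I_1,I_2$ are intervals of $\mathbb{R}$. Define $\alpha\ast\omega:I_1\times I_2\subset\mathbb{R}^2\to\mathbb{C}^2$ as follows. If $\varphi\neq\pi/2$, $$(\alpha\ast\omega)(t,s)=\left(\frac{|\omega(s)|^2-|\alpha(t)|^2}{2\cos\varphi}+(\tan\varphi-i)(\arg\alpha'(t)+\arg\dot\omega(s)),\ \alpha(t)\omega(s)\right);$$ if $\varphi=\pi/2$, $$(\alpha\ast\omega)(t,s)=\left(\int_{t_0}^t\langle\alpha',J\alpha\rangle(x)\,dx-\int_{s_0}^s\langle\dot\omega,J\omega\rangle(y)\,dy-i(\arg\alpha'(t)+\arg\dot\omega(s)),\ \alpha(t)\omega(s)\right),$$ where $'$ and $\dot{}$ denote the derivatives with respect to $t$ and $s$ respectively, $t_0\in I_1$ and $s_0\in I_2$. Then $\alpha\ast\omega$ is a Lagrangian translating soliton for mean curvature flow with translating vector $(1,0)\in\mathbb{C}^2$, whose induced metric is $(|\alpha|^2+|\omega|^2)(dt^2+ds^2)$ and whose Lagrangian angle map is $\arg\alpha'+\arg\dot\omega+\pi+\varphi$.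
   Context: On $\mathbb{C}^2\equiv\mathbb{R}^4$ let $(z,w)=z_1\bar w_1+z_2\bar w_2$, $\langle\cdot,\cdot\rangle=\mathrm{Re}(\cdot,\cdot)$ the Euclidean metric, $J$ the complex structure (multiplication by $i$), and $-\mathrm{Im}(\cdot,\cdot)=\langle J\cdot,\cdot\rangle$ the Kähler form. An immersion $\phi:M\to\mathbb{C}^2$ of a surface is Lagrangian if the Kähler form pulls back to $0$. For an oriented Lagrangian surface with area form $\omega_M$, the Lagrangian angle map $\beta:M\to\mathbb{R}/2\pi\mathbb{Z}$ is defined by $\phi^*(dz_1\wedge dz_2)=e^{i\beta}\omega_M$. The mean curvature vector is $H=\mathrm{trace}\,\sigma$, with $\sigma$ the second fundamental form. $\phi$ is a translating soliton for mean curvature flow with translating vector $\mathbf{e}$ ($\mathbf{e}\in\mathbb{R}^4$ a nonzero constant vector) if $H=\mathbf{e}^\perp$, the normal projection of $\mathbf{e}$. For a unit speed planar curve $\alpha$ in $\mathbb{C}$, $J$ is multiplication by $i$, the curvature $\kappa_\alpha$ is given by $\alpha''=\kappa_\alpha J\alpha'$, the curvature vector is $\overrightarrow{\kappa_\alpha}=\kappa_\alpha J\alpha'$, and $\langle\cdot,\cdot\rangle$ is the Euclidean inner product of $\mathbb{C}\equiv\mathbb{R}^2$. $\arg\alpha'$ and $\arg\dot\omega$ denote continuous determinations of the argument. $I_1\times I_2$ carries the orientation given by $(t,s)$.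
   Formalization: The Lagrangian immersion, soliton and angle claims are made only at (t,s) where α(t) and ω(s) are not both 0, since at a common zero the induced metric vanishes and α∗ω is not an immersion (e.g. φ=0, α(t)=t, ω(s)=s at (0,0)). *)

theory Defs
  imports "HOL-Analysis.Analysis"
begin

text \<open>
  Derivatives are taken within the domain, so that intervals need not be open; they are unique
  on non-degenerate intervals, on products of two such, and on relatively open subsets of these.
\<close>

primrec Ck_on :: "nat \<Rightarrow> 'a::real_normed_vector set \<Rightarrow> ('a \<Rightarrow> 'b::real_normed_vector) \<Rightarrow> bool" where
  "Ck_on 0 S f \<longleftrightarrow> continuous_on S f"
| "Ck_on (Suc n) S f \<longleftrightarrow>
     (\<exists>f'. (\<forall>x\<in>S. (f has_derivative f' x) (at x within S)) \<and> (\<forall>v. Ck_on n S (\<lambda>x. f' x v)))"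

definition smooth_on :: "'a::real_normed_vector set \<Rightarrow> ('a \<Rightarrow> 'b::real_normed_vector) \<Rightarrow> bool" where
  "smooth_on S f \<longleftrightarrow> (\<forall>n. Ck_on n S f)"

definition normal_part :: "'a::real_inner set \<Rightarrow> 'a \<Rightarrow> 'a" where
  "normal_part T v = (THE n. v - n \<in> span T \<and> (\<forall>x\<in>T. orthogonal n x))"

definition nondegenerate_interval :: "real set \<Rightarrow> bool" where
  "nondegenerate_interval I \<longleftrightarrow> is_interval I \<and> interior I \<noteq> {}"

definition velocity :: "real set \<Rightarrow> (real \<Rightarrow> complex) \<Rightarrow> real \<Rightarrow> complex" where
  "velocity I c t = vector_derivative c (at t within I)"

definition unit_speed_curve :: "real set \<Rightarrow> (real \<Rightarrow> complex) \<Rightarrow> bool" where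
  "unit_speed_curve I c \<longleftrightarrow> smooth_on I c \<and> (\<forall>t\<in>I. norm (velocity I c t) = 1)"

definition curvature :: "real set \<Rightarrow> (real \<Rightarrow> complex) \<Rightarrow> real \<Rightarrow> real" where
  "curvature I c t = (THE k. velocity I (velocity I c) t = k *\<^sub>R (\<i> * velocity I c t))"

definition curvature_vector :: "real set \<Rightarrow> (real \<Rightarrow> complex) \<Rightarrow> real \<Rightarrow> complex" where
  "curvature_vector I c t = curvature I c t *\<^sub>R (\<i> * velocity I c t)"

definition continuous_arg :: "real set \<Rightarrow> (real \<Rightarrow> complex) \<Rightarrow> (real \<Rightarrow> real) \<Rightarrow> bool" where
  "continuous_arg I f \<theta> \<longleftrightarrow> continuous_on I \<theta> \<and> (\<forall>t\<in>I. is_Arg (f t) (\<theta> t))"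

text \<open>
  A surface is given by a map \<open>F\<close> on a set \<open>M\<close> of parameters in the plane, which is oriented
  by its standard basis. The Euclidean metric of the target is the library's \<open>inner\<close> on
  \<open>complex \<times> complex\<close>, which is the real part of \<open>herm\<close>.
\<close>

type_synonym surface = "real \<times> real \<Rightarrow> complex \<times> complex"

definition herm :: "complex \<times> complex \<Rightarrow> complex \<times> complex \<Rightarrow> complex" where
  "herm z w = fst z * cnj (fst w) + snd z * cnj (snd w)"

definition kaehler_form :: "complex \<times> complex \<Rightarrow> complex \<times> complex \<Rightarrow> real" where
  "kaehler_form z w = - Im (herm z w)"

definition dz1_wedge_dz2 :: "complex \<times> complex \<Rightarrow> complex \<times> complex \<Rightarrow> complex" where
  "dz1_wedge_dz2 z w = fst z * snd w - fst w * snd z"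

definition dif :: "(real \<times> real) set \<Rightarrow> surface \<Rightarrow> real \<times> real \<Rightarrow> real \<times> real \<Rightarrow> complex \<times> complex" where
  "dif M F p = frechet_derivative F (at p within M)"

definition immersion_on :: "(real \<times> real) set \<Rightarrow> surface \<Rightarrow> bool" where
  "immersion_on M F \<longleftrightarrow> smooth_on M F \<and> (\<forall>p\<in>M. inj (dif M F p))"

definition induced_metric ::
  "(real \<times> real) set \<Rightarrow> surface \<Rightarrow> real \<times> real \<Rightarrow> real \<times> real \<Rightarrow> real \<times> real \<Rightarrow> real" where
  "induced_metric M F p u v = inner (dif M F p u) (dif M F p v)"

definition lagrangian_immersion_on :: "(real \<times> real) set \<Rightarrow> surface \<Rightarrow> bool" where
  "lagrangian_immersion_on M F \<longleftrightarrow>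
     immersion_on M F \<and> (\<forall>p\<in>M. \<forall>u v. kaehler_form (dif M F p u) (dif M F p v) = 0)"

definition metric_det :: "(real \<times> real) set \<Rightarrow> surface \<Rightarrow> real \<times> real \<Rightarrow> real" where
  "metric_det M F p =
     induced_metric M F p (1, 0) (1, 0) * induced_metric M F p (0, 1) (0, 1)
       - (induced_metric M F p (1, 0) (0, 1))\<^sup>2"

definition area_form ::
  "(real \<times> real) set \<Rightarrow> surface \<Rightarrow> real \<times> real \<Rightarrow> real \<times> real \<Rightarrow> real \<times> real \<Rightarrow> real" where
  "area_form M F p u v = sqrt (metric_det M F p) * (fst u * snd v - fst v * snd u)"

text \<open>The angle map takes values modulo \<open>2 * pi\<close>; here \<open>\<beta>\<close> is a real-valued representative.\<close>

definition lagrangian_angle_map ::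
  "(real \<times> real) set \<Rightarrow> surface \<Rightarrow> (real \<times> real \<Rightarrow> real) \<Rightarrow> bool" where
  "lagrangian_angle_map M F \<beta> \<longleftrightarrow>
     (\<forall>p\<in>M. \<forall>u v. dz1_wedge_dz2 (dif M F p u) (dif M F p v)
        = exp (\<i> * of_real (\<beta> p)) * of_real (area_form M F p u v))"

text \<open>
  For constant coordinate fields \<open>u\<close>, \<open>v\<close> the second fundamental form is the normal part of the
  second directional derivative of \<open>F\<close>. The mean curvature vector is its (unnormalised) trace,
  the contraction with the inverse matrix of the first fundamental form.
\<close>

definition second_fundamental_form ::
  "(real \<times> real) set \<Rightarrow> surface \<Rightarrow> real \<times> real \<Rightarrow> real \<times> real \<Rightarrow> real \<times> real \<Rightarrow> complex \<times> complex" where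
  "second_fundamental_form M F p u v =
     normal_part (range (dif M F p)) (dif M (\<lambda>q. dif M F q v) p u)"

definition mean_curvature_vector ::
  "(real \<times> real) set \<Rightarrow> surface \<Rightarrow> real \<times> real \<Rightarrow> complex \<times> complex" where
  "mean_curvature_vector M F p =
     (let g = induced_metric M F p; \<sigma> = second_fundamental_form M F p; a = (1, 0); b = (0, 1)
      in (1 / metric_det M F p) *\<^sub>R (g b b *\<^sub>R \<sigma> a a - (2 * g a b) *\<^sub>R \<sigma> a b + g a a *\<^sub>R \<sigma> b b))"

definition translating_soliton_on ::
  "(real \<times> real) set \<Rightarrow> surface \<Rightarrow> complex \<times> complex \<Rightarrow> bool" where
  "translating_soliton_on M F e \<longleftrightarrow>
     e \<noteq> 0 \<and> immersion_on M F \<and>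
     (\<forall>p\<in>M. mean_curvature_vector M F p = normal_part (range (dif M F p)) e)"

text \<open>
  Here \<open>\<theta>\<^sub>1\<close> and \<open>\<theta>\<^sub>2\<close> stand for the chosen arguments of the velocities of \<open>\<alpha>\<close> and \<open>\<omega>\<close>.
  The interval integrals are oriented, so the base points may lie on either side.
\<close>

definition curve_product ::
  "real \<Rightarrow> real set \<Rightarrow> real set \<Rightarrow> (real \<Rightarrow> complex) \<Rightarrow> (real \<Rightarrow> complex) \<Rightarrow>
   (real \<Rightarrow> real) \<Rightarrow> (real \<Rightarrow> real) \<Rightarrow> real \<Rightarrow> real \<Rightarrow> surface" where
  "curve_product \<phi> I\<^sub>1 I\<^sub>2 \<alpha> \<omega> \<theta>\<^sub>1 \<theta>\<^sub>2 t\<^sub>0 s\<^sub>0 = (\<lambda>(t, s).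
     (if \<phi> \<noteq> pi / 2
      then of_real (((norm (\<omega> s))\<^sup>2 - (norm (\<alpha> t))\<^sup>2) / (2 * cos \<phi>))
           + (of_real (tan \<phi>) - \<i>) * of_real (\<theta>\<^sub>1 t + \<theta>\<^sub>2 s)
      else of_real (LBINT x=t\<^sub>0..t. inner (velocity I\<^sub>1 \<alpha> x) (\<i> * \<alpha> x))
           - of_real (LBINT y=s\<^sub>0..s. inner (velocity I\<^sub>2 \<omega> y) (\<i> * \<omega> y))
           - \<i> * of_real (\<theta>\<^sub>1 t + \<theta>\<^sub>2 s),
      \<alpha> t * \<omega> s))"

text \<open>
  Both curves may pass through the origin, as the lines \<open>\<alpha> t = t\<close> and \<open>\<omega> s = s\<close> do for \<open>\<phi> = 0\<close>.
  At such a pair of parameters the differential of the product surface vanishes.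
\<close>

definition regular_parameters ::
  "real set \<Rightarrow> real set \<Rightarrow> (real \<Rightarrow> complex) \<Rightarrow> (real \<Rightarrow> complex) \<Rightarrow> (real \<times> real) set" where
  "regular_parameters I\<^sub>1 I\<^sub>2 \<alpha> \<omega> = {(t, s). t \<in> I\<^sub>1 \<and> s \<in> I\<^sub>2 \<and> \<not> (\<alpha> t = 0 \<and> \<omega> s = 0)}"

end

theory Submission
  imports Defs
begin

text \<open>
  With \<open>T = \<alpha>'\<close> and \<open>W = \<omega>'\<close>, the curvature equations make \<open>arg \<alpha>'\<close> and \<open>arg \<omega>'\<close> antiderivatives of
  \<open>- Im (cis (- \<phi>) * \<alpha> * cnj T)\<close> and \<open>Im (cis (- \<phi>) * \<omega> * cnj W)\<close>, and both formulas for the first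
  component of \<open>F\<close> then have the same derivatives:
  \<open>F\<^sub>t = (- cis \<phi> * cnj \<alpha> * T, T * \<omega>)\<close> and \<open>F\<^sub>s = (cis \<phi> * cnj \<omega> * W, \<alpha> * W)\<close>.
  These vectors are Hermitian orthogonal with common squared norm \<open>\<bar>\<alpha>\<bar>\<^sup>2 + \<bar>\<omega>\<bar>\<^sup>2\<close>, which gives the metric,
  the Lagrangian condition and the angle. Moreover \<open>F\<^sub>t\<^sub>t + F\<^sub>s\<^sub>s\<close> equals \<open>\<kappa>\<^sub>\<alpha> * \<i> F\<^sub>t + \<kappa>\<^sub>\<omega> * \<i> F\<^sub>s\<close>, and
  \<open>\<kappa>\<^sub>\<alpha>\<close>, \<open>\<kappa>\<^sub>\<omega>\<close> are exactly the inner products of \<open>(1, 0)\<close> with \<open>\<i> F\<^sub>t\<close>, \<open>\<i> F\<^sub>s\<close>.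
\<close>

subsection \<open>Smooth maps on arbitrary sets\<close>

lemma Ck_on_subset: "Ck_on n S f \<Longrightarrow> T \<subseteq> S \<Longrightarrow> Ck_on n T f"
proof (induction n arbitrary: f)
  case 0
  then show ?case using continuous_on_subset by auto
next
  case (Suc n)
  then obtain f' where "\<forall>x\<in>S. (f has_derivative f' x) (at x within S)"
      "\<forall>v. Ck_on n S (\<lambda>x. f' x v)"
    by auto
  with Suc show ?case
    by (auto intro!: exI[of _ f'] has_derivative_subset[of f _ _ S T])
qed

lemma Ck_on_cong:
  assumes "\<And>x. x \<in> S \<Longrightarrow> g x = f x" "Ck_on n S f"
  shows "Ck_on n S g"
proof (cases n)
  case 0
  then show ?thesis using assms continuous_on_cong[of S S g f] by auto
next
  case (Suc m)
  then obtain f' where "\<forall>x\<in>S. (f has_derivative f' x) (at x within S)"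
      "\<forall>v. Ck_on m S (\<lambda>x. f' x v)"
    using assms(2) by auto
  with Suc show ?thesis
    using has_derivative_transform[of _ S g f, OF _ assms(1)] by (auto intro!: exI[of _ f'])
qed

text \<open>Lowers the order by one. At order 0 this is continuity of differentiable maps; above it
  the same derivative serves, with its directional derivatives lowered by induction.\<close>

lemma Ck_on_Suc_imp: "Ck_on (Suc n) S f \<Longrightarrow> Ck_on n S f"
proof (induction n arbitrary: f)
  case 0
  then show ?case
    using has_derivative_continuous continuous_on_eq_continuous_within by fastforce
next
  case (Suc n)
  \<comment> \<open>Only the outermost level is unfolded, so the directional derivatives keep the
    form \<open>Ck_on (Suc n)\<close> that the induction hypothesis expects.\<close>
  from Suc.prems obtain f' where f': "\<forall>x\<in>S. (f has_derivative f' x) (at x within S)"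
      "\<And>v. Ck_on (Suc n) S (\<lambda>x. f' x v)"
    by (auto simp only: Ck_on.simps(2)[of "Suc n"])
  have "Ck_on n S (\<lambda>x. f' x v)" for v
    using Suc.IH f'(2) by blast
  with f'(1) show ?case
    by (auto simp only: Ck_on.simps(2)[of n])
qed

lemma Ck_on_linear_comp:
  assumes "bounded_linear L" "Ck_on n S f"
  shows "Ck_on n S (\<lambda>x. L (f x))"
  using assms(2)
proof (induction n arbitrary: f)
  case 0
  then show ?case using assms(1) by (auto intro: bounded_linear.continuous_on)
next
  case (Suc n)
  then obtain f' where "\<forall>x\<in>S. (f has_derivative f' x) (at x within S)"
      "\<forall>v. Ck_on n S (\<lambda>x. f' x v)"
    by auto
  with Suc.IH show ?case
    by (auto intro!: exI[of _ "\<lambda>x v. L (f' x v)"] bounded_linear.has_derivative[OF assms(1)])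
qed

text \<open>The derivative in direction \<open>v\<close> is the directional derivative of
  \<open>f\<close> in the fixed direction \<open>L v\<close>, again composed with \<open>L\<close>,
  so the induction closes.\<close>

lemma Ck_on_compose_linear:
  assumes "bounded_linear L" "L ` T \<subseteq> S" "Ck_on n S f"
  shows "Ck_on n T (\<lambda>x. f (L x))"
  using assms(3)
proof (induction n arbitrary: f)
  case 0
  then show ?case
    using continuous_on_compose2[OF _ linear_continuous_on[OF assms(1)] assms(2), of f] by simp
next
  case (Suc n)
  then obtain f' where f': "\<forall>x\<in>S. (f has_derivative f' x) (at x within S)"
      "\<forall>v. Ck_on n S (\<lambda>x. f' x v)"
    by auto
  have "((\<lambda>x. f (L x)) has_derivative (\<lambda>v. f' (L x) (L v))) (at x within T)" if "x \<in> T" for x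
    using f'(1) that assms(1,2)
    by (intro has_derivative_in_compose2[of S f f' L T x L])
       (auto intro: bounded_linear_imp_has_derivative)
  with f'(2) Suc.IH show ?case
    by (auto intro!: exI[of _ "\<lambda>x v. f' (L x) (L v)"])
qed

lemma Ck_on_const: "Ck_on n S (\<lambda>x. c)"
proof (induction n arbitrary: c)
  case (Suc n)
  then show ?case by (auto intro!: exI[of _ "\<lambda>x v. 0"])
qed auto

lemma Ck_on_add: "Ck_on n S f \<Longrightarrow> Ck_on n S g \<Longrightarrow> Ck_on n S (\<lambda>x. f x + g x)"
proof (induction n arbitrary: f g)
  case 0
  then show ?case by (auto intro: continuous_on_add)
next
  case (Suc n)
  then obtain f' g' where "\<forall>x\<in>S. (f has_derivative f' x) (at x within S)"
      "\<forall>v. Ck_on n S (\<lambda>x. f' x v)" "\<forall>x\<in>S. (g has_derivative g' x) (at x within S)"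
      "\<forall>v. Ck_on n S (\<lambda>x. g' x v)"
    by (auto simp only: Ck_on.simps)
  with Suc.IH show ?case
    by (auto intro!: exI[of _ "\<lambda>x v. f' x v + g' x v"] has_derivative_add)
qed

text \<open>The product rule pairs each derivative with an undifferentiated factor, which
  \<open>Ck_on_Suc_imp\<close> brings down to the order of the induction hypothesis.\<close>

lemma Ck_on_bilinear:
  assumes "bounded_bilinear m" "Ck_on n S f" "Ck_on n S g"
  shows "Ck_on n S (\<lambda>x. m (f x) (g x))"
  using assms(2,3)
proof (induction n arbitrary: f g)
  case 0
  then show ?case using assms(1) by (auto intro: bounded_bilinear.continuous_on)
next
  case (Suc n)
  then obtain f' g' where "\<forall>x\<in>S. (f has_derivative f' x) (at x within S)"
      "\<forall>v. Ck_on n S (\<lambda>x. f' x v)" "\<forall>x\<in>S. (g has_derivative g' x) (at x within S)"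
      "\<forall>v. Ck_on n S (\<lambda>x. g' x v)"
    by (auto simp only: Ck_on.simps)
  with Suc.IH Suc.prems[THEN Ck_on_Suc_imp] show ?case
    by (auto intro!: exI[of _ "\<lambda>x v. m (f x) (g' x v) + m (f' x v) (g x)"] Ck_on_add
        bounded_bilinear.FDERIV[OF assms(1)])
qed

section \<open>Closure rules for smooth maps\<close>

lemma smooth_on_subset: "smooth_on S f \<Longrightarrow> T \<subseteq> S \<Longrightarrow> smooth_on T f"
  unfolding smooth_on_def using Ck_on_subset by blast

lemma smooth_on_imp_continuous_on: "smooth_on S f \<Longrightarrow> continuous_on S f"
  unfolding smooth_on_def using Ck_on.simps(1) by blast

lemma smooth_on_linear_comp:
  "bounded_linear L \<Longrightarrow> smooth_on S f \<Longrightarrow> smooth_on S (\<lambda>x. L (f x))"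
  unfolding smooth_on_def using Ck_on_linear_comp by blast

lemma smooth_on_fst: "smooth_on I f \<Longrightarrow> smooth_on (I \<times> J) (\<lambda>p. f (fst p))"
  unfolding smooth_on_def by (auto intro!: Ck_on_compose_linear[OF bounded_linear_fst, of "I \<times> J" I])

lemma smooth_on_snd: "smooth_on J f \<Longrightarrow> smooth_on (I \<times> J) (\<lambda>p. f (snd p))"
  unfolding smooth_on_def by (auto intro!: Ck_on_compose_linear[OF bounded_linear_snd, of "I \<times> J" J])

lemma smooth_on_const: "smooth_on S (\<lambda>x. c)"
  unfolding smooth_on_def using Ck_on_const by blast

lemma smooth_on_add: "smooth_on S f \<Longrightarrow> smooth_on S g \<Longrightarrow> smooth_on S (\<lambda>x. f x + g x)"
  unfolding smooth_on_def using Ck_on_add by blast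

lemma smooth_on_mult:
  fixes f g :: "'a::real_normed_vector \<Rightarrow> 'b::real_normed_algebra"
  shows "smooth_on S f \<Longrightarrow> smooth_on S g \<Longrightarrow> smooth_on S (\<lambda>x. f x * g x)"
  unfolding smooth_on_def using Ck_on_bilinear[OF bounded_bilinear_mult] by blast

lemma smooth_on_Pair:
  assumes "smooth_on S f" "smooth_on S g"
  shows "smooth_on S (\<lambda>x. (f x, g x))"
proof -
  \<comment> \<open>The pair is the sum of its images under the two linear embeddings of the
    factors.\<close>
  have "smooth_on S (\<lambda>x. (f x, 0) + (0, g x))"
    by (intro smooth_on_add smooth_on_linear_comp[of "\<lambda>z. (z, 0)" S f]
        smooth_on_linear_comp[of "\<lambda>z. (0, z)" S g] bounded_linear_Pair
        bounded_linear_ident bounded_linear_zero assms)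
  then show ?thesis by simp
qed

text \<open>The hypotheses are literally order \<open>Suc n\<close> for every \<open>n\<close>;
  dropping one order also covers continuity at \<open>n = 0\<close>.\<close>

lemma smooth_on_has_derivative:
  assumes "\<And>x. x \<in> S \<Longrightarrow> (f has_derivative f' x) (at x within S)"
    and "\<And>v. smooth_on S (\<lambda>x. f' x v)"
  shows "smooth_on S f"
  unfolding smooth_on_def
proof
  fix n
  have "Ck_on (Suc n) S f"
    using assms unfolding smooth_on_def by auto
  then show "Ck_on n S f" by (rule Ck_on_Suc_imp)
qed

subsection \<open>Uniqueness of derivatives on rectangles\<close>

lemma nondegenerate_interval_islimpt:
  assumes "nondegenerate_interval I" "t \<in> I"
  shows "t islimpt I"
proof (rule connected_imp_perfect)
  show "connected I"
    using assms(1) by (simp add: nondegenerate_interval_def is_interval_connected)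
  show "I \<noteq> {x}" for x
    using assms(1) by (auto simp: nondegenerate_interval_def)
qed fact

lemma nondegenerate_interval_at_neq_bot:
  "nondegenerate_interval I \<Longrightarrow> t \<in> I \<Longrightarrow> at t within I \<noteq> bot"
  using nondegenerate_interval_islimpt trivial_limit_within by blast

text \<open>From any point of the rectangle, corners included, arbitrarily small nonzero moves along
  each axis stay inside, and a linear map is determined by its values on the axes.\<close>

lemma has_derivative_unique_rectangle:
  assumes I: "nondegenerate_interval I" and J: "nondegenerate_interval J" and p: "p \<in> I \<times> J"
    and f: "(f has_derivative D) (at p within I \<times> J)" "(f has_derivative D') (at p within I \<times> J)"
  shows "D = D'"
proof (rule frechet_derivative_unique_within[OF f])
  obtain t s where ts: "p = (t, s)" "t \<in> I" "s \<in> J" using p by auto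
  fix i :: "real \<times> real" and e :: real
  assume i: "i \<in> Basis" and e: "0 < e"
  obtain t' where t': "t' \<in> I" "t' \<noteq> t" "dist t' t < e"
    using nondegenerate_interval_islimpt[OF I ts(2)] e by (auto simp: islimpt_approachable)
  obtain s' where s': "s' \<in> J" "s' \<noteq> s" "dist s' s < e"
    using nondegenerate_interval_islimpt[OF J ts(3)] e by (auto simp: islimpt_approachable)
  from i have "i = (1, 0) \<or> i = (0, 1)" by (auto simp: Basis_prod_def)
  then show "\<exists>d. 0 < \<bar>d\<bar> \<and> \<bar>d\<bar> < e \<and> p + d *\<^sub>R i \<in> I \<times> J"
  proof
    assume "i = (1, 0)"
    with t' ts show ?thesis by (intro exI[of _ "t' - t"]) (auto simp: dist_real_def)
  next
    assume "i = (0, 1)"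
    with s' ts show ?thesis by (intro exI[of _ "s' - s"]) (auto simp: dist_real_def)
  qed
qed

text \<open>Turns the choice operator behind \<open>dif\<close> into a computable value. The set
  \<open>M\<close> matters only through its filter at \<open>p\<close>, which lets a relatively open
  part of a rectangle inherit uniqueness.\<close>

lemma dif_eqI:
  assumes "nondegenerate_interval I" "nondegenerate_interval J" "p \<in> I \<times> J"
    and "at p within M = at p within I \<times> J"
    and "(f has_derivative D) (at p within M)"
  shows "dif M f p = D"
  unfolding dif_def frechet_derivative_def
proof (rule some_equality)
  show "D' = D" if "(f has_derivative D') (at p within M)" for D'
    using has_derivative_unique_rectangle[OF assms(1-3)] that assms(4,5) by metis
qed (rule assms(5))

subsection \<open>Normal parts\<close>

text \<open>The difference of two candidates lies in the span and is orthogonal to it, hence to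
  itself.\<close>

lemma normal_part_eqI:
  assumes "v - n \<in> span T" "\<And>x. x \<in> T \<Longrightarrow> orthogonal n x"
  shows "normal_part T v = n"
  unfolding normal_part_def
proof (rule the_equality)
  fix m assume m: "v - m \<in> span T \<and> (\<forall>x\<in>T. orthogonal m x)"
  have "(v - n) - (v - m) \<in> span T"
    using span_diff[OF assms(1)] m by blast
  then have "m - n \<in> span T" by simp
  moreover have "orthogonal (m - n) x" if "x \<in> T" for x
    using that m assms(2) by (auto simp: orthogonal_def inner_diff_left)
  ultimately have "orthogonal (m - n) (m - n)"
    by (rule orthogonal_to_span)
  then show "m = n" by (simp add: orthogonal_self)
qed (use assms in auto)

text \<open>Serves to merge the terms of the trace of the second fundamental form into one normal
  part. Finite dimension supplies the orthogonal decomposition that makes the definite description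
  denote.\<close>

lemma normal_part_add:
  fixes x y :: "'a::euclidean_space"
  shows "normal_part T (x + y) = normal_part T x + normal_part T y"
proof -
  have dec: "\<exists>n. v - n \<in> span T \<and> (\<forall>w\<in>T. orthogonal n w)" for v :: 'a
  proof -
    obtain a n where an: "a \<in> span T" "\<And>w. w \<in> span T \<Longrightarrow> orthogonal n w" "v = a + n"
      using orthogonal_subspace_decomp_exists by blast
    then have "v - n \<in> span T" "\<forall>w\<in>T. orthogonal n w"
      using span_base by auto
    then show ?thesis by blast
  qed
  obtain m where m: "x - m \<in> span T" "\<And>w. w \<in> T \<Longrightarrow> orthogonal m w"
    using dec[of x] by blast
  obtain n where n: "y - n \<in> span T" "\<And>w. w \<in> T \<Longrightarrow> orthogonal n w"
    using dec[of y] by blast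
  have "(x - m) + (y - n) \<in> span T"
    using m n by (intro span_add)
  then have "normal_part T (x + y) = m + n"
    using m(2) n(2)
    by (intro normal_part_eqI) (auto simp: algebra_simps orthogonal_def inner_add_left)
  with m n show ?thesis by (simp add: normal_part_eqI)
qed

lemma normal_part_unit:
  assumes "norm T = 1"
  shows "normal_part {T} v = v - inner v T *\<^sub>R T"
proof (rule normal_part_eqI)
  show "v - (v - inner v T *\<^sub>R T) \<in> span {T}"
    by (simp add: span_base span_scale)
  show "orthogonal (v - inner v T *\<^sub>R T) x" if "x \<in> {T}" for x
    using that assms by (simp add: orthogonal_def inner_diff_left dot_square_norm)
qed

subsection \<open>Unit speed curves\<close>

text \<open>The derivative witnessing \<open>Ck_on (Suc n)\<close> may vary with \<open>n\<close>,
  but by uniqueness its value at 1 is always \<open>velocity I c\<close>, which is therefore of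
  every finite order.\<close>

lemma unit_speed_velocity:
  assumes I: "nondegenerate_interval I" and c: "unit_speed_curve I c"
  shows "\<And>t. t \<in> I \<Longrightarrow> (c has_vector_derivative velocity I c t) (at t within I)"
    and "smooth_on I (velocity I c)"
proof -
  have *: "(\<forall>t\<in>I. (c has_vector_derivative velocity I c t) (at t within I)) \<and> Ck_on n I (velocity I c)" for n
  proof -
    have "Ck_on (Suc n) I c"
      using c by (simp only: unit_speed_curve_def smooth_on_def)
    then obtain c' where c': "\<And>t. t \<in> I \<Longrightarrow> (c has_derivative c' t) (at t within I)"
      "Ck_on n I (\<lambda>t. c' t 1)" by auto
    have d: "(c has_vector_derivative c' t 1) (at t within I)" if "t \<in> I" for t
    proof -
      have "(\<lambda>r. r *\<^sub>R c' t 1) = c' t"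
      proof
        fix r
        show "r *\<^sub>R c' t 1 = c' t r"
          using linear_scale[OF has_derivative_linear[OF c'(1)[OF that]], of r 1] by simp
      qed
      with c'(1)[OF that] show ?thesis by (simp only: has_vector_derivative_def)
    qed
    have "velocity I c t = c' t 1" if "t \<in> I" for t
      unfolding velocity_def
      using vector_derivative_within[OF nondegenerate_interval_at_neq_bot[OF I that] d[OF that]] .
    with d c'(2) show ?thesis
      using Ck_on_cong[of I "velocity I c" "\<lambda>t. c' t 1" n] by auto
  qed
  show "\<And>t. t \<in> I \<Longrightarrow> (c has_vector_derivative velocity I c t) (at t within I)"
    using * by blast
  show "smooth_on I (velocity I c)" using * by (simp add: smooth_on_def)
qed

text \<open>Differentiating the constant squared speed makes the acceleration orthogonal to the
  velocity; in the plane it is then a multiple of \<open>\<i>\<close> times the velocity, so the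
  description defining \<open>curvature\<close> has a unique solution.\<close>

lemma unit_speed_frenet:
  assumes I: "nondegenerate_interval I" and c: "unit_speed_curve I c" and t: "t \<in> I"
  shows "(velocity I c has_vector_derivative curvature_vector I c t) (at t within I)"
proof -
  let ?T = "velocity I c"
  have un: "norm (?T x) = 1" if "x \<in> I" for x
    using c that by (simp add: unit_speed_curve_def)
  have "Ck_on (Suc 0) I ?T"
    using unit_speed_velocity(2)[OF I c] by (simp only: smooth_on_def)
  then obtain T' where "(?T has_derivative T') (at t within I)"
    using t by auto
  then have d: "(?T has_vector_derivative velocity I ?T t) (at t within I)"
    unfolding velocity_def using vector_derivative_works differentiableI by blast
  let ?A = "velocity I ?T t"
  have "((\<lambda>x. inner (?T x) (?T x)) has_vector_derivative 2 * inner (?T t) ?A) (at t within I)"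
    using d unfolding has_vector_derivative_def
    by (auto intro!: derivative_eq_intros simp: inner_commute)
  moreover have "((\<lambda>x. inner (?T x) (?T x)) has_vector_derivative 0) (at t within I)"
    unfolding has_vector_derivative_def
    by (rule has_derivative_transform[OF t, of _ "\<lambda>x. 1"]) (use un in \<open>auto simp: dot_square_norm\<close>)
  ultimately have "2 * inner (?T t) ?A = 0"
    using vector_derivative_unique_within[OF nondegenerate_interval_at_neq_bot[OF I t]] by blast
  then have orth: "Re (?T t) * Re ?A + Im (?T t) * Im ?A = 0"
    by (simp add: inner_complex_def)
  have n1: "(Re (?T t))\<^sup>2 + (Im (?T t))\<^sup>2 = 1"
    using un[OF t] by (simp add: cmod_def)
  \<comment> \<open>The product of \<open>?A\<close> with \<open>cnj (?T t)\<close> has real part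
    \<open>inner ?A (?T t) = 0\<close>, so it is \<open>\<i>\<close> times its imaginary part;
    multiplying back by \<open>?T t\<close> recovers \<open>?A\<close> because the speed is
    1.\<close>
  define k where "k = Im (?A * cnj (?T t))"
  have A: "?A = k *\<^sub>R (\<i> * ?T t)"
  proof -
    have "?A = (?A * cnj (?T t)) * ?T t"
      using un[OF t] by (simp add: mult.assoc complex_norm_square[symmetric] mult.commute)
    also have "?A * cnj (?T t) = \<i> * of_real k"
      using orth by (simp add: complex_eq_iff k_def algebra_simps)
    finally show ?thesis by (simp add: scaleR_conv_of_real mult.assoc mult.left_commute)
  qed
  have "\<i> * ?T t \<noteq> 0" using un[OF t] by auto
  then have "curvature I c t = k"
    unfolding curvature_def A by (intro the_equality) auto
  with A d show ?thesis by (simp add: curvature_vector_def)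
qed

text \<open>Continuity forces \<theta> to agree near \<open>t\<close> with a branch of the logarithm
  of the velocity. Dividing by the velocity at \<open>t\<close> places the argument of
  \<open>Ln\<close> at 1, away from the branch cut and with derivative 1.\<close>

lemma continuous_arg_has_vector_derivative:
  assumes I: "nondegenerate_interval I" and c: "unit_speed_curve I c"
    and \<theta>: "continuous_arg I (velocity I c) \<theta>" and t: "t \<in> I"
  shows "(\<theta> has_vector_derivative curvature I c t) (at t within I)"
proof -
  let ?T = "velocity I c"
  have T: "?T x = cis (\<theta> x)" if "x \<in> I" for x
    using c \<theta> that
    by (simp add: unit_speed_curve_def continuous_arg_def is_Arg_def cis_conv_exp)
  have "continuous (at t within I) \<theta>"
    using \<theta> t by (simp add: continuous_arg_def continuous_on_eq_continuous_within)
  \<comment> \<open>An oscillation below \<open>pi / 2\<close> keeps the difference of arguments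
    inside the principal strip, where \<open>Ln\<close> inverts \<open>exp\<close>.\<close>
  then obtain d where d: "d > 0" "\<And>x. x \<in> I \<Longrightarrow> dist x t < d \<Longrightarrow> dist (\<theta> x) (\<theta> t) < pi / 2"
    unfolding continuous_within_eps_delta by (metis pi_half_gt_zero)
  define L where "L = (\<lambda>x. \<theta> t + Im (Ln (?T x * cnj (?T t))))"
  have "L x = \<theta> x" if "x \<in> I" "dist x t < d" for x
  proof -
    have "?T x * cnj (?T t) = exp (\<i> * of_real (\<theta> x - \<theta> t))"
      using T[OF that(1)] T[OF t] by (simp add: cis_cnj cis_mult) (simp add: cis_conv_exp)
    moreover have "Ln (exp (\<i> * of_real (\<theta> x - \<theta> t))) = \<i> * of_real (\<theta> x - \<theta> t)"
      using d(2)[OF that] pi_gt_zero by (intro Ln_exp) (auto simp: dist_real_def abs_if split: if_splits)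
    ultimately show ?thesis by (simp add: L_def)
  qed
  moreover have "(L has_vector_derivative curvature I c t) (at t within I)"
  proof -
    have one: "?T t * cnj (?T t) = 1"
      using T[OF t] by (simp add: cis_cnj cis_mult)
    have "((\<lambda>x. ?T x * cnj (?T t)) has_vector_derivative curvature_vector I c t * cnj (?T t)) (at t within I)"
      using unit_speed_frenet[OF I c t] by (intro has_vector_derivative_mult_left)
    then have "((\<lambda>x. ?T x * cnj (?T t)) has_vector_derivative of_real (curvature I c t) * \<i>) (at t within I)"
      using one by (simp add: curvature_vector_def scaleR_conv_of_real mult.assoc)
    moreover have "(Ln has_field_derivative 1) (at (?T t * cnj (?T t)))"
      using has_field_derivative_Ln[of 1] one by simp
    ultimately have "((\<lambda>x. Ln (?T x * cnj (?T t))) has_vector_derivative of_real (curvature I c t) * \<i>) (at t within I)"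
      using field_vector_diff_chain_within[of "\<lambda>x. ?T x * cnj (?T t)" _ t I Ln 1]
      by (simp add: o_def has_field_derivative_at_within)
    from has_vector_derivative_add[OF has_vector_derivative_const
        bounded_linear.has_vector_derivative[OF bounded_linear_Im this], of "\<theta> t"]
    show ?thesis by (simp add: L_def)
  qed
  ultimately show ?thesis
    unfolding has_vector_derivative_def
    using has_derivative_transform_within[of L _ t I d \<theta>] d(1) t by blast
qed

text \<open>The fundamental theorem is applied on a compact subinterval that contains
  \<open>t0\<close> and coincides with \<open>I\<close> near \<open>t\<close>, so both give the same
  filter at \<open>t\<close>.\<close>

lemma interval_integral_has_vector_derivative_within:
  fixes f :: "real \<Rightarrow> 'a::euclidean_space"
  assumes I: "is_interval I" and f: "continuous_on I f" and t0: "t0 \<in> I" and t: "t \<in> I"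
  shows "((\<lambda>u. LBINT x=t0..u. f x) has_vector_derivative f t) (at t within I)"
proof -
  \<comment> \<open>If \<open>I\<close> has points left of \<open>t\<close>, one of them serves as
    both bounds. Otherwise \<open>t\<close> is the left endpoint: then \<open>l = t\<close>, and
    \<open>t - 1\<close> is an arbitrary open bound below it. The right side is symmetric.\<close>
  obtain l l' where l: "l \<in> I" "l \<le> t" "l' < t" "\<And>y. y \<in> I \<Longrightarrow> l' < y \<Longrightarrow> l \<le> y"
  proof (cases "\<exists>y\<in>I. y < t")
    case True
    then obtain y where "y \<in> I" "y < t" by blast
    then show thesis using that[of y y] by simp
  next
    case False
    then show thesis using that[of t "t - 1"] t by fastforce
  qed
  obtain r r' where r: "r \<in> I" "t \<le> r" "t < r'" "\<And>y. y \<in> I \<Longrightarrow> y < r' \<Longrightarrow> y \<le> r"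
  proof (cases "\<exists>y\<in>I. t < y")
    case True
    then obtain y where "y \<in> I" "t < y" by blast
    then show thesis using that[of y y] by simp
  next
    case False
    then show thesis using that[of t "t + 1"] t by fastforce
  qed
  define a b where "a = min l t0" and "b = max r t0"
  have ab: "a \<in> I" "b \<in> I" using l r t0 by (auto simp: a_def b_def min_def max_def)
  then have sub: "{a..b} \<subseteq> I"
    using I unfolding is_interval_1 by (meson atLeastAtMost_iff subsetI)
  have "((\<lambda>u. LBINT x=t0..u. f x) has_vector_derivative f t) (at t within {a..b})"
    using l r by (intro interval_integral_FTC2 continuous_on_subset[OF f sub]) (auto simp: a_def b_def)
  moreover have "{a..b} \<inter> {l'<..<r'} - {t} = I \<inter> {l'<..<r'} - {t}"
    using sub l(4) r(4) by (auto simp: a_def b_def min_le_iff_disj le_max_iff_disj)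
  then have "at t within {a..b} = at t within I"
    using l r by (intro at_within_nhd[of t "{l'<..<r'}"]) auto
  ultimately show ?thesis by simp
qed

lemma has_derivative_fst_rectangle:
  assumes "(f has_vector_derivative f') (at (fst p) within I)" "p \<in> I \<times> J"
  shows "((\<lambda>q. f (fst q)) has_derivative (\<lambda>v. fst v *\<^sub>R f')) (at p within I \<times> J)"
  using assms
  by (intro has_derivative_in_compose[of fst fst p "I \<times> J" f "\<lambda>x. x *\<^sub>R f'"])
     (auto simp: has_vector_derivative_def intro!: derivative_eq_intros intro: has_derivative_subset)

lemma has_derivative_snd_rectangle:
  assumes "(f has_vector_derivative f') (at (snd p) within J)" "p \<in> I \<times> J"
  shows "((\<lambda>q. f (snd q)) has_derivative (\<lambda>v. snd v *\<^sub>R f')) (at p within I \<times> J)"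
  using assms
  by (intro has_derivative_in_compose[of snd snd p "I \<times> J" f "\<lambda>x. x *\<^sub>R f'"])
     (auto simp: has_vector_derivative_def intro!: derivative_eq_intros intro: has_derivative_subset)

text \<open>Pairing the vector equation with \<open>\<i>\<close> times the velocity removes every
  tangential term; multiplication by \<open>\<i>\<close> is an isometry, which simplifies the second
  coefficient.\<close>

lemma curvature_of_normal_parts:
  assumes "norm (velocity I c t) = 1"
    and "curvature_vector I c t = a *\<^sub>R normal_part {velocity I c t} p
      + b *\<^sub>R normal_part {velocity I c t} (\<i> * p)"
  shows "curvature I c t = a * inner p (\<i> * velocity I c t) + b * inner p (velocity I c t)"
proof -
  define T where "T = velocity I c t"
  have T: "inner T T = 1" "Re T * Re T + Im T * Im T = 1"
    using assms(1) by (simp_all add: T_def dot_square_norm flip: inner_complex_def)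
  have "curvature I c t *\<^sub>R (\<i> * T) = a *\<^sub>R (p - inner p T *\<^sub>R T)
      + b *\<^sub>R (\<i> * p - inner (\<i> * p) T *\<^sub>R T)"
    using assms by (simp add: T_def curvature_vector_def normal_part_unit)
  then have "inner (curvature I c t *\<^sub>R (\<i> * T)) (\<i> * T) = inner (a *\<^sub>R (p - inner p T *\<^sub>R T)
      + b *\<^sub>R (\<i> * p - inner (\<i> * p) T *\<^sub>R T)) (\<i> * T)" by (rule arg_cong)
  moreover have "inner (\<i> * T) (\<i> * T) = 1" "inner T (\<i> * T) = 0" "inner (\<i> * p) (\<i> * T) = inner p T"
    using T by (simp_all add: inner_complex_def algebra_simps)
  ultimately show ?thesis
    by (simp add: T_def[symmetric] inner_add_left inner_diff_left)
qed

text \<open>The first component of the product surface is a sum of two potentials, with \<open>\<epsilon> = - 1\<close>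
  for \<open>\<alpha>\<close> and \<open>\<epsilon> = 1\<close> for \<open>\<omega>\<close>.\<close>

definition potential ::
  "real \<Rightarrow> real set \<Rightarrow> (real \<Rightarrow> complex) \<Rightarrow> (real \<Rightarrow> real) \<Rightarrow> real \<Rightarrow> real \<Rightarrow> real \<Rightarrow> complex" where
  "potential \<phi> I c \<theta> t0 \<epsilon> t =
     (if \<phi> \<noteq> pi / 2
      then of_real (\<epsilon> * (norm (c t))\<^sup>2 / (2 * cos \<phi>)) + (of_real (tan \<phi>) - \<i>) * of_real (\<theta> t)
      else - of_real (\<epsilon> * (LBINT x=t0..t. inner (velocity I c x) (\<i> * c x))) - \<i> * of_real (\<theta> t))"

lemma cos_nonzero_between_0_pi:
  assumes "0 \<le> \<phi>" "\<phi> < pi" "\<phi> \<noteq> pi / 2"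
  shows "cos \<phi> \<noteq> 0"
proof (cases "\<phi> < pi / 2")
  case True
  then show ?thesis using assms cos_gt_zero_pi[of \<phi>] by simp
next
  case False
  then have "cos (pi - \<phi>) > 0" using assms by (intro cos_gt_zero_pi) auto
  then show ?thesis by simp
qed

text \<open>The condition on the curvature says that the derivative of \<theta> is minus the
  imaginary part of the claimed derivative. The remaining term of each branch is chosen to supply
  the real part.\<close>

lemma potential_has_vector_derivative:
  assumes \<phi>: "0 \<le> \<phi>" "\<phi> < pi"
    and I: "nondegenerate_interval I" and t0: "t0 \<in> I"
    and c: "unit_speed_curve I c" and \<theta>: "continuous_arg I (velocity I c) \<theta>" and t: "t \<in> I"
    and k: "curvature I c t = \<epsilon> * (cos \<phi> * inner (c t) (\<i> * velocity I c t) - sin \<phi> * inner (c t) (velocity I c t))"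
  shows "(potential \<phi> I c \<theta> t0 \<epsilon> has_vector_derivative
    of_real \<epsilon> * cis \<phi> * cnj (c t) * velocity I c t) (at t within I)"
proof -
  let ?T = "velocity I c t"
  have d\<theta>: "(\<theta> has_vector_derivative curvature I c t) (at t within I)"
    using continuous_arg_has_vector_derivative[OF I c \<theta> t] .
  have d\<theta>': "((\<lambda>t. complex_of_real (\<theta> t)) has_vector_derivative of_real (curvature I c t)) (at t within I)"
    using bounded_linear.has_vector_derivative[OF bounded_linear_of_real d\<theta>] .
  have dc: "(c has_vector_derivative ?T) (at t within I)"
    using unit_speed_velocity(1)[OF I c t] .
  show ?thesis
  proof (cases "\<phi> = pi / 2")
    case False
    have cs: "cos \<phi> \<noteq> 0" by (rule cos_nonzero_between_0_pi[OF \<phi> False])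
    have "((\<lambda>t. inner (c t) (c t)) has_vector_derivative 2 * inner (c t) ?T) (at t within I)"
      using dc unfolding has_vector_derivative_def
      by (auto intro!: derivative_eq_intros simp: inner_commute)
    then have "((\<lambda>t. (norm (c t))\<^sup>2) has_vector_derivative 2 * inner (c t) ?T) (at t within I)"
      by (simp add: dot_square_norm)
    from has_vector_derivative_mult_right[OF this, of "\<epsilon> / (2 * cos \<phi>)"]
    have "((\<lambda>t. \<epsilon> * (norm (c t))\<^sup>2 / (2 * cos \<phi>)) has_vector_derivative
        \<epsilon> / (2 * cos \<phi>) * (2 * inner (c t) ?T)) (at t within I)"
      by (simp only: times_divide_eq_left)
    then have "((\<lambda>t. complex_of_real (\<epsilon> * (norm (c t))\<^sup>2 / (2 * cos \<phi>))) has_vector_derivative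
        of_real (\<epsilon> / (2 * cos \<phi>) * (2 * inner (c t) ?T))) (at t within I)"
      by (rule bounded_linear.has_vector_derivative[OF bounded_linear_of_real])
    moreover have "((\<lambda>t. (of_real (tan \<phi>) - \<i>) * complex_of_real (\<theta> t)) has_vector_derivative
        (of_real (tan \<phi>) - \<i>) * of_real (curvature I c t)) (at t within I)"
      by (rule has_vector_derivative_mult_right[OF d\<theta>'])
    ultimately have "(potential \<phi> I c \<theta> t0 \<epsilon> has_vector_derivative
        of_real (\<epsilon> / (2 * cos \<phi>) * (2 * inner (c t) ?T)) + (of_real (tan \<phi>) - \<i>) * of_real (curvature I c t))
        (at t within I)"
      unfolding potential_def using False by (simp add: has_vector_derivative_add)
    moreover have "of_real (\<epsilon> / (2 * cos \<phi>) * (2 * inner (c t) ?T)) + (of_real (tan \<phi>) - \<i>) * of_real (curvature I c t)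
        = of_real \<epsilon> * cis \<phi> * cnj (c t) * ?T"
    proof -
      define a where "a = inner (c t) ?T"
      define b where "b = inner (c t) (\<i> * ?T)"
      have p: "cnj (c t) * ?T = Complex a (- b)"
        by (simp add: a_def b_def inner_complex_def complex_eq_iff)
      have k': "curvature I c t = \<epsilon> * (cos \<phi> * b - sin \<phi> * a)"
        using k by (simp add: a_def b_def)
      \<comment> \<open>The real part: \<theta> also enters it through the factor
        \<open>tan \<phi>\<close>, and the squared sine this produces turns
        \<open>a / cos \<phi>\<close> into \<open>a * cos \<phi>\<close>.\<close>
      have "\<epsilon> * a / cos \<phi> + tan \<phi> * (\<epsilon> * (cos \<phi> * b - sin \<phi> * a)) = \<epsilon> * (cos \<phi> * a + sin \<phi> * b)"
      proof -
        have "\<epsilon> * a + sin \<phi> * (\<epsilon> * (cos \<phi> * b - sin \<phi> * a)) = \<epsilon> * (a * (1 - (sin \<phi>)\<^sup>2) + sin \<phi> * cos \<phi> * b)"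
          by (simp add: algebra_simps power2_eq_square)
        also have "1 - (sin \<phi>)\<^sup>2 = (cos \<phi>)\<^sup>2" by (simp add: cos_squared_eq)
        finally show ?thesis using cs by (simp add: tan_def field_simps power2_eq_square)
      qed
      then show ?thesis
        unfolding mult.assoc p k' a_def[symmetric] by (simp add: complex_eq_iff algebra_simps)
    qed
    ultimately show ?thesis by simp
  next
    case True
    have "continuous_on I (\<lambda>x. inner (velocity I c x) (\<i> * c x))"
      using unit_speed_velocity(2)[OF I c] c unfolding unit_speed_curve_def
      by (intro continuous_intros) (auto intro: smooth_on_imp_continuous_on)
    from interval_integral_has_vector_derivative_within[OF _ this t0 t] I
    have "((\<lambda>u. LBINT x=t0..u. inner (velocity I c x) (\<i> * c x)) has_vector_derivative
        inner ?T (\<i> * c t)) (at t within I)"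
      by (simp add: nondegenerate_interval_def)
    from has_vector_derivative_mult_right[OF this, of \<epsilon>]
    have "((\<lambda>u. complex_of_real (\<epsilon> * (LBINT x=t0..u. inner (velocity I c x) (\<i> * c x)))) has_vector_derivative
        of_real (\<epsilon> * inner ?T (\<i> * c t))) (at t within I)"
      by (rule bounded_linear.has_vector_derivative[OF bounded_linear_of_real])
    moreover have "((\<lambda>t. \<i> * complex_of_real (\<theta> t)) has_vector_derivative
        \<i> * of_real (curvature I c t)) (at t within I)"
      by (rule has_vector_derivative_mult_right[OF d\<theta>'])
    ultimately have "(potential \<phi> I c \<theta> t0 \<epsilon> has_vector_derivative
        - of_real (\<epsilon> * inner ?T (\<i> * c t)) - \<i> * of_real (curvature I c t)) (at t within I)"
      unfolding potential_def using True
      by (simp del: of_real_mult add: has_vector_derivative_diff has_vector_derivative_minus)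
    \<comment> \<open>Here \<open>cis \<phi>\<close> is \<open>\<i>\<close>, and the integrand is
      \<open>- inner (c t) (\<i> * ?T)\<close> because multiplication by \<open>\<i>\<close> is
      skew.\<close>
    moreover have "- of_real (\<epsilon> * inner ?T (\<i> * c t)) - \<i> * of_real (curvature I c t)
        = of_real \<epsilon> * cis \<phi> * cnj (c t) * ?T"
      using k unfolding True by (simp add: complex_eq_iff inner_complex_def algebra_simps)
    ultimately show ?thesis by simp
  qed
qed

subsection \<open>Surfaces in complex two-space\<close>

text \<open>In conformal coordinates the inverse metric is \<open>1 / r\<close> times the identity,
  so the mixed term drops out and only the two pure second derivatives remain. The differential is
  prescribed on all of \<open>M\<close> because it is differentiated again at
  \<open>p\<close>.\<close>

lemma mean_curvature_vector_conformal:
  assumes I: "nondegenerate_interval I" and J: "nondegenerate_interval J" and MK: "M \<subseteq> I \<times> J"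
    and at: "at p within M = at p within I \<times> J" and p: "p \<in> M"
    and dF: "\<And>q. q \<in> M \<Longrightarrow> dif M F q = (\<lambda>v. fst v *\<^sub>R X q + snd v *\<^sub>R Y q)"
    and X: "(X has_derivative X') (at p within M)" and Y: "(Y has_derivative Y') (at p within M)"
    and g: "inner (X p) (X p) = r" "inner (Y p) (Y p) = r" "inner (X p) (Y p) = 0" "r \<noteq> 0"
  shows "mean_curvature_vector M F p
    = (1 / r) *\<^sub>R normal_part (range (dif M F p)) (X' (1, 0) + Y' (0, 1))"
proof -
  have pK: "p \<in> I \<times> J" using p MK by blast
  have "((\<lambda>q. dif M F q (1, 0)) has_derivative X') (at p within M)"
    by (rule has_derivative_transform[OF p _ X]) (simp add: dF)
  then have X2: "dif M (\<lambda>q. dif M F q (1, 0)) p = X'"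
    by (rule dif_eqI[OF I J pK at])
  have "((\<lambda>q. dif M F q (0, 1)) has_derivative Y') (at p within M)"
    by (rule has_derivative_transform[OF p _ Y]) (simp add: dF)
  then have Y2: "dif M (\<lambda>q. dif M F q (0, 1)) p = Y'"
    by (rule dif_eqI[OF I J pK at])
  have "induced_metric M F p (1, 0) (1, 0) = r" "induced_metric M F p (0, 1) (0, 1) = r"
    "induced_metric M F p (1, 0) (0, 1) = 0"
    using g by (simp_all add: induced_metric_def dF[OF p])
  then show ?thesis
    using g(4)
    by (simp add: mean_curvature_vector_def Let_def metric_det_def second_fundamental_form_def X2 Y2
        normal_part_add flip: scaleR_right_distrib)
qed

section \<open>Hermitian algebra of the coordinate tangent vectors\<close>

lemma inner_eq_Re_herm: "inner z w = Re (herm z w)"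
  by (cases z; cases w) (simp add: herm_def inner_complex_def inner_prod_def)

text \<open>The coordinate vectors of the surface, with the values of the curves and their
  velocities as plain complex numbers, so that the identities below are pure algebra.\<close>

definition tangent_t :: "real \<Rightarrow> complex \<Rightarrow> complex \<Rightarrow> complex \<Rightarrow> complex \<times> complex" where
  "tangent_t \<phi> a T w = (- cis \<phi> * cnj a * T, T * w)"

definition tangent_s :: "real \<Rightarrow> complex \<Rightarrow> complex \<Rightarrow> complex \<Rightarrow> complex \<times> complex" where
  "tangent_s \<phi> a w W = (cis \<phi> * cnj w * W, a * W)"

text \<open>Everything reduces to \<open>cis \<phi>\<close>, \<open>T\<close> and \<open>W\<close>
  having modulus 1; in the mixed products the contributions of the two components cancel.\<close>

lemma herm_tangent:
  fixes a w T W :: complex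
  assumes T: "norm T = 1" and W: "norm W = 1"
  defines "r \<equiv> complex_of_real ((norm a)\<^sup>2 + (norm w)\<^sup>2)"
  shows "herm (tangent_t \<phi> a T w) (tangent_t \<phi> a T w) = r"
    and "herm (tangent_s \<phi> a w W) (tangent_s \<phi> a w W) = r"
    and "herm (tangent_t \<phi> a T w) (tangent_s \<phi> a w W) = 0"
    and "herm (tangent_s \<phi> a w W) (tangent_t \<phi> a T w) = 0"
    and "dz1_wedge_dz2 (tangent_t \<phi> a T w) (tangent_s \<phi> a w W) = - (cis \<phi> * T * W * r)"
proof -
  define u where "u = cis \<phi>"
  have u: "u * cnj u = 1" by (simp add: u_def cis_cnj cis_mult)
  have T1: "T * cnj T = 1" and W1: "W * cnj W = 1"
    using T W by (simp_all flip: complex_norm_square)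
  have r: "r = a * cnj a + w * cnj w"
    by (simp only: r_def of_real_add complex_norm_square)
  note d = herm_def dz1_wedge_dz2_def tangent_t_def tangent_s_def u_def[symmetric] r
  show "herm (tangent_t \<phi> a T w) (tangent_t \<phi> a T w) = r"
  proof -
    have "herm (tangent_t \<phi> a T w) (tangent_t \<phi> a T w)
        = (u * cnj u) * (T * cnj T) * (a * cnj a) + (T * cnj T) * (w * cnj w)"
      by (simp add: d algebra_simps)
    then show ?thesis by (simp add: u T1 r)
  qed
  show "herm (tangent_s \<phi> a w W) (tangent_s \<phi> a w W) = r"
  proof -
    have "herm (tangent_s \<phi> a w W) (tangent_s \<phi> a w W)
        = (u * cnj u) * (W * cnj W) * (w * cnj w) + (W * cnj W) * (a * cnj a)"
      by (simp add: d algebra_simps)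
    then show ?thesis by (simp add: u W1 r)
  qed
  show "herm (tangent_t \<phi> a T w) (tangent_s \<phi> a w W) = 0"
  proof -
    have "herm (tangent_t \<phi> a T w) (tangent_s \<phi> a w W)
        = (1 - u * cnj u) * (T * cnj W * w * cnj a)"
      by (simp add: d algebra_simps)
    then show ?thesis by (simp add: u)
  qed
  show "herm (tangent_s \<phi> a w W) (tangent_t \<phi> a T w) = 0"
  proof -
    have "herm (tangent_s \<phi> a w W) (tangent_t \<phi> a T w)
        = (1 - u * cnj u) * (W * cnj T * cnj w * a)"
      by (simp add: d algebra_simps)
    then show ?thesis by (simp add: u)
  qed
  show "dz1_wedge_dz2 (tangent_t \<phi> a T w) (tangent_s \<phi> a w W) = - (cis \<phi> * T * W * r)"
    by (simp add: d algebra_simps)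
qed

text \<open>The coefficients are real, so all products of tangent vectors are real: the real part
  gives the conformal metric and the vanishing imaginary part the Lagrangian condition.\<close>

lemma herm_combination:
  assumes "herm X X = of_real r" "herm Y Y = of_real r" "herm X Y = 0" "herm Y X = 0"
  shows "herm (fst u *\<^sub>R X + snd u *\<^sub>R Y) (fst v *\<^sub>R X + snd v *\<^sub>R Y) = of_real (r * inner u v)"
proof -
  have "herm (fst u *\<^sub>R X + snd u *\<^sub>R Y) (fst v *\<^sub>R X + snd v *\<^sub>R Y)
      = of_real (fst u * fst v) * herm X X + of_real (snd u * snd v) * herm Y Y
        + of_real (fst u * snd v) * herm X Y + of_real (snd u * fst v) * herm Y X"
    by (simp add: herm_def scaleR_conv_of_real algebra_simps)
  then show ?thesis
    using assms by (simp add: inner_prod_def algebra_simps)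
qed

text \<open>The curvatures of the two curves are the imaginary parts of the Hermitian coordinates of
  \<open>(1, 0)\<close> in the orthogonal basis \<open>X\<close>, \<open>Y\<close>.\<close>

lemma e1_decomposition:
  assumes T: "norm T = 1" and W: "norm W = 1"
    and k: "k = sin \<phi> * inner a T - cos \<phi> * inner a (\<i> * T)"
    and l: "l = cos \<phi> * inner w (\<i> * W) - sin \<phi> * inner w W"
  defines "X \<equiv> tangent_t \<phi> a T w" and "Y \<equiv> tangent_s \<phi> a w W"
  shows "((norm a)\<^sup>2 + (norm w)\<^sup>2) *\<^sub>R (1, 0) - (k *\<^sub>R (\<i> * fst X, \<i> * snd X) + l *\<^sub>R (\<i> * fst Y, \<i> * snd Y))
    = inner (1, 0) X *\<^sub>R X + inner (1, 0) Y *\<^sub>R Y"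
proof -
  define u where "u = cis \<phi>"
  have u: "u * cnj u = 1" by (simp add: u_def cis_cnj cis_mult)
  have T1: "T * cnj T = 1" and W1: "W * cnj W = 1"
    using T W by (simp_all flip: complex_norm_square)
  have r: "complex_of_real ((norm a)\<^sup>2 + (norm w)\<^sup>2) = a * cnj a + w * cnj w"
    by (simp only: of_real_add complex_norm_square)
  \<comment> \<open>The Hermitian product of \<open>(1, 0)\<close> with \<open>X\<close> is
    \<open>cnj (fst X)\<close>; its real part is the inner product and its imaginary part is
    \<open>k\<close>.\<close>
  have hX: "of_real (inner (1, 0) X) + \<i> * of_real k = - cnj u * a * cnj T"
    by (simp add: X_def tangent_t_def k u_def complex_eq_iff inner_complex_def inner_prod_def algebra_simps)
  have hY: "of_real (inner (1, 0) Y) + \<i> * of_real l = cnj u * w * cnj W"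
    by (simp add: Y_def tangent_s_def l u_def complex_eq_iff inner_complex_def inner_prod_def algebra_simps)
  \<comment> \<open>Hermitian expansion of \<open>(1, 0)\<close>, scaled by the common squared norm,
    in the basis \<open>X\<close>, \<open>Y\<close>, one component at a time.\<close>
  have "(- cnj u * a * cnj T) * fst X + (cnj u * w * cnj W) * fst Y
      = (u * cnj u) * (T * cnj T) * (a * cnj a) + (u * cnj u) * (W * cnj W) * (w * cnj w)"
    by (simp add: X_def Y_def tangent_t_def tangent_s_def u_def[symmetric] algebra_simps)
  then have 1: "(- cnj u * a * cnj T) * fst X + (cnj u * w * cnj W) * fst Y = of_real ((norm a)\<^sup>2 + (norm w)\<^sup>2)"
    by (simp only: u T1 W1 r mult_1)
  have "(- cnj u * a * cnj T) * snd X + (cnj u * w * cnj W) * snd Y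
      = cnj u * a * w * (W * cnj W - T * cnj T)"
    by (simp add: X_def Y_def tangent_t_def tangent_s_def algebra_simps)
  then have 2: "(- cnj u * a * cnj T) * snd X + (cnj u * w * cnj W) * snd Y = 0"
    by (simp add: T1 W1)
  \<comment> \<open>Splitting the complex coefficients and moving the multiples by
    \<open>\<i>\<close> to the left leaves a real combination of the basis vectors.\<close>
  have *: "R - (k *\<^sub>R (\<i> * x) + l *\<^sub>R (\<i> * y)) = p *\<^sub>R x + q *\<^sub>R y"
    if "(of_real p + \<i> * of_real k) * x + (of_real q + \<i> * of_real l) * y = R" for p q R x y
    using that[symmetric] by (simp add: scaleR_conv_of_real algebra_simps)
  show ?thesis
    using *[OF 1[folded hX hY]] *[OF 2[folded hX hY]]
    by (simp add: prod_eq_iff scaleR_conv_of_real)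
qed

subsection \<open>The product of two curves\<close>

text \<open>The removed parameters are the preimage of a point under a continuous map, so the
  regular ones are relatively open in the rectangle.\<close>

lemma at_within_regular_parameters:
  assumes "continuous_on I \<alpha>" "continuous_on J \<omega>" "p \<in> regular_parameters I J \<alpha> \<omega>"
  shows "at p within regular_parameters I J \<alpha> \<omega> = at p within I \<times> J"
proof -
  define M where "M = regular_parameters I J \<alpha> \<omega>"
  have "continuous_on (I \<times> J) (\<lambda>q. (\<alpha> (fst q), \<omega> (snd q)))"
    using assms(1,2)
    by (intro continuous_on_Pair continuous_on_compose2[of I \<alpha> _ fst]
        continuous_on_compose2[of J \<omega> _ snd] continuous_intros) auto
  then have "openin (top_of_set (I \<times> J)) (I \<times> J \<inter> (\<lambda>q. (\<alpha> (fst q), \<omega> (snd q))) -` (- {(0, 0)}))"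
    by (intro continuous_openin_preimage_gen) auto
  moreover have "I \<times> J \<inter> (\<lambda>q. (\<alpha> (fst q), \<omega> (snd q))) -` (- {(0, 0)}) = M"
    by (auto simp: M_def regular_parameters_def)
  ultimately obtain S where "open S" "M = I \<times> J \<inter> S"
    by (auto simp: openin_open)
  then show ?thesis
    using assms(3) unfolding M_def[symmetric] by (intro at_within_nhd[of p S]) auto
qed

locale soliton_curves =
  fixes \<phi> t\<^sub>0 s\<^sub>0 :: real and I\<^sub>1 I\<^sub>2 :: "real set"
    and \<alpha> \<omega> :: "real \<Rightarrow> complex" and \<theta>\<^sub>1 \<theta>\<^sub>2 :: "real \<Rightarrow> real"
  assumes phi: "0 \<le> \<phi>" "\<phi> < pi"
    and I1: "nondegenerate_interval I\<^sub>1" and I2: "nondegenerate_interval I\<^sub>2"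
    and t0: "t\<^sub>0 \<in> I\<^sub>1" and s0: "s\<^sub>0 \<in> I\<^sub>2"
    and alpha: "unit_speed_curve I\<^sub>1 \<alpha>" and omega: "unit_speed_curve I\<^sub>2 \<omega>"
    and alpha_curvature: "\<And>t. t \<in> I\<^sub>1 \<Longrightarrow> curvature_vector I\<^sub>1 \<alpha> t =
           - cos \<phi> *\<^sub>R normal_part {velocity I\<^sub>1 \<alpha> t} (\<alpha> t)
           + sin \<phi> *\<^sub>R normal_part {velocity I\<^sub>1 \<alpha> t} (\<i> * \<alpha> t)"
    and omega_curvature: "\<And>s. s \<in> I\<^sub>2 \<Longrightarrow> curvature_vector I\<^sub>2 \<omega> s =
           cos \<phi> *\<^sub>R normal_part {velocity I\<^sub>2 \<omega> s} (\<omega> s)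
           - sin \<phi> *\<^sub>R normal_part {velocity I\<^sub>2 \<omega> s} (\<i> * \<omega> s)"
    and arg1: "continuous_arg I\<^sub>1 (velocity I\<^sub>1 \<alpha>) \<theta>\<^sub>1"
    and arg2: "continuous_arg I\<^sub>2 (velocity I\<^sub>2 \<omega>) \<theta>\<^sub>2"
begin

abbreviation "K \<equiv> I\<^sub>1 \<times> I\<^sub>2"
abbreviation "M \<equiv> regular_parameters I\<^sub>1 I\<^sub>2 \<alpha> \<omega>"
abbreviation "F \<equiv> curve_product \<phi> I\<^sub>1 I\<^sub>2 \<alpha> \<omega> \<theta>\<^sub>1 \<theta>\<^sub>2 t\<^sub>0 s\<^sub>0"
abbreviation "T \<equiv> velocity I\<^sub>1 \<alpha>"
abbreviation "W \<equiv> velocity I\<^sub>2 \<omega>"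
abbreviation "X p \<equiv> tangent_t \<phi> (\<alpha> (fst p)) (T (fst p)) (\<omega> (snd p))"
abbreviation "Y p \<equiv> tangent_s \<phi> (\<alpha> (fst p)) (\<omega> (snd p)) (W (snd p))"
abbreviation "r p \<equiv> (norm (\<alpha> (fst p)))\<^sup>2 + (norm (\<omega> (snd p)))\<^sup>2"

lemma T_norm: "t \<in> I\<^sub>1 \<Longrightarrow> norm (T t) = 1" and W_norm: "s \<in> I\<^sub>2 \<Longrightarrow> norm (W s) = 1"
  using alpha omega by (auto simp: unit_speed_curve_def)

lemma M_subset: "M \<subseteq> K"
  by (auto simp: regular_parameters_def)

lemma r_pos: "p \<in> M \<Longrightarrow> r p > 0"
  by (auto simp: regular_parameters_def add_pos_nonneg add_nonneg_pos)

lemma at_within_M: "p \<in> M \<Longrightarrow> at p within M = at p within K"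
  using alpha omega
  by (intro at_within_regular_parameters)
     (auto simp: unit_speed_curve_def smooth_on_imp_continuous_on)

section \<open>Derivatives of the product surface\<close>

lemma curvature_alpha:
  assumes "t \<in> I\<^sub>1"
  shows "curvature I\<^sub>1 \<alpha> t = sin \<phi> * inner (\<alpha> t) (T t) - cos \<phi> * inner (\<alpha> t) (\<i> * T t)"
  using curvature_of_normal_parts[OF T_norm[OF assms], of "- cos \<phi>" "\<alpha> t" "sin \<phi>"]
    alpha_curvature[OF assms] by simp

lemma curvature_omega:
  assumes "s \<in> I\<^sub>2"
  shows "curvature I\<^sub>2 \<omega> s = cos \<phi> * inner (\<omega> s) (\<i> * W s) - sin \<phi> * inner (\<omega> s) (W s)"
  using curvature_of_normal_parts[OF W_norm[OF assms], of "cos \<phi>" "\<omega> s" "- sin \<phi>"]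
    omega_curvature[OF assms] by simp

text \<open>Separates the variables, so that both partial derivatives come from the one-variable
  lemma on \<open>potential\<close>.\<close>

lemma F_eq_potentials:
  "F = (\<lambda>p. (potential \<phi> I\<^sub>1 \<alpha> \<theta>\<^sub>1 t\<^sub>0 (- 1) (fst p) + potential \<phi> I\<^sub>2 \<omega> \<theta>\<^sub>2 s\<^sub>0 1 (snd p),
    \<alpha> (fst p) * \<omega> (snd p)))"
  by (auto simp: fun_eq_iff curve_product_def potential_def diff_divide_distrib algebra_simps)

lemma has_derivative_F:
  assumes p: "p \<in> K"
  shows "(F has_derivative (\<lambda>v. fst v *\<^sub>R X p + snd v *\<^sub>R Y p)) (at p within K)"
proof -
  have fs: "fst p \<in> I\<^sub>1" "snd p \<in> I\<^sub>2" using p by auto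
  \<comment> \<open>The factors \<open>- 1\<close> here and \<open>1\<close> below put the
    curvatures in the form required for \<open>\<epsilon> = - 1\<close> and
    \<open>\<epsilon> = 1\<close>.\<close>
  have k: "curvature I\<^sub>1 \<alpha> (fst p) = - 1 * (cos \<phi> * inner (\<alpha> (fst p)) (\<i> * T (fst p)) - sin \<phi> * inner (\<alpha> (fst p)) (T (fst p)))"
    using curvature_alpha[OF fs(1)] by simp
  have l: "curvature I\<^sub>2 \<omega> (snd p) = 1 * (cos \<phi> * inner (\<omega> (snd p)) (\<i> * W (snd p)) - sin \<phi> * inner (\<omega> (snd p)) (W (snd p)))"
    using curvature_omega[OF fs(2)] by simp
  note d1 = has_derivative_fst_rectangle[OF potential_has_vector_derivative[OF phi I1 t0 alpha arg1 fs(1) k] p]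
  note d2 = has_derivative_snd_rectangle[OF potential_has_vector_derivative[OF phi I2 s0 omega arg2 fs(2) l] p]
  note d3 = has_derivative_fst_rectangle[OF unit_speed_velocity(1)[OF I1 alpha fs(1)] p]
  note d4 = has_derivative_snd_rectangle[OF unit_speed_velocity(1)[OF I2 omega fs(2)] p]
  show ?thesis
    unfolding F_eq_potentials
    by (rule has_derivative_eq_rhs[OF has_derivative_Pair[OF has_derivative_add[OF d1 d2] has_derivative_mult[OF d3 d4]]])
       (simp add: fun_eq_iff tangent_t_def tangent_s_def scaleR_conv_of_real algebra_simps)
qed

text \<open>Only the value at \<open>(1, 0)\<close>, the second derivative in \<open>t\<close>,
  enters the conformal trace. Its summand 1 comes from differentiating \<open>cnj \<alpha>\<close>,
  as the velocity has modulus 1.\<close>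

lemma has_derivative_X:
  assumes p: "p \<in> K"
  shows "\<exists>X'. (X has_derivative X') (at p within K) \<and> X' (1, 0) =
    (- cis \<phi> * (1 + \<i> * of_real (curvature I\<^sub>1 \<alpha> (fst p)) * cnj (\<alpha> (fst p)) * T (fst p)),
     \<i> * of_real (curvature I\<^sub>1 \<alpha> (fst p)) * T (fst p) * \<omega> (snd p))"
proof -
  have fs: "fst p \<in> I\<^sub>1" "snd p \<in> I\<^sub>2" using p by auto
  have 1: "cnj (T (fst p)) * T (fst p) = 1"
    using T_norm[OF fs(1)] by (simp add: mult.commute flip: complex_norm_square)
  note a = has_derivative_fst_rectangle[OF unit_speed_velocity(1)[OF I1 alpha fs(1)] p]
  note da = bounded_linear.has_derivative[OF bounded_linear_cnj a]
  note dT = has_derivative_fst_rectangle[OF unit_speed_frenet[OF I1 alpha fs(1)] p]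
  note dw = has_derivative_snd_rectangle[OF unit_speed_velocity(1)[OF I2 omega fs(2)] p]
  show ?thesis
    unfolding tangent_t_def
    by (intro exI conjI, rule has_derivative_Pair[OF has_derivative_mult[OF has_derivative_mult_right[OF da] dT] has_derivative_mult[OF dT dw]])
       (use 1 in \<open>simp add: curvature_vector_def scaleR_conv_of_real algebra_simps\<close>)
qed

lemma has_derivative_Y:
  assumes p: "p \<in> K"
  shows "\<exists>Y'. (Y has_derivative Y') (at p within K) \<and> Y' (0, 1) =
    (cis \<phi> * (1 + \<i> * of_real (curvature I\<^sub>2 \<omega> (snd p)) * cnj (\<omega> (snd p)) * W (snd p)),
     \<i> * of_real (curvature I\<^sub>2 \<omega> (snd p)) * \<alpha> (fst p) * W (snd p))"
proof -
  have fs: "fst p \<in> I\<^sub>1" "snd p \<in> I\<^sub>2" using p by auto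
  have 1: "cnj (W (snd p)) * W (snd p) = 1"
    using W_norm[OF fs(2)] by (simp add: mult.commute flip: complex_norm_square)
  note da = has_derivative_fst_rectangle[OF unit_speed_velocity(1)[OF I1 alpha fs(1)] p]
  note w = has_derivative_snd_rectangle[OF unit_speed_velocity(1)[OF I2 omega fs(2)] p]
  note dw = bounded_linear.has_derivative[OF bounded_linear_cnj w]
  note dW = has_derivative_snd_rectangle[OF unit_speed_frenet[OF I2 omega fs(2)] p]
  show ?thesis
    unfolding tangent_s_def
    by (intro exI conjI, rule has_derivative_Pair[OF has_derivative_mult[OF has_derivative_mult_right[OF dw] dW] has_derivative_mult[OF da dW]])
       (use 1 in \<open>simp add: curvature_vector_def scaleR_conv_of_real algebra_simps\<close>)
qed

text \<open>The arguments in the first component are given only as continuous functions; smoothness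
  is read off from the derivative, which involves just the curves and their velocities.\<close>

lemma smooth_F: "smooth_on K F"
proof (rule smooth_on_has_derivative[OF has_derivative_F])
  have sm: "smooth_on I\<^sub>1 \<alpha>" "smooth_on I\<^sub>2 \<omega>" "smooth_on I\<^sub>1 T" "smooth_on I\<^sub>2 W"
    using alpha omega unit_speed_velocity(2) I1 I2 by (auto simp: unit_speed_curve_def)
  note fs = smooth_on_fst[OF sm(1), of I\<^sub>2] smooth_on_snd[OF sm(2), of I\<^sub>1]
    smooth_on_fst[OF sm(3), of I\<^sub>2] smooth_on_snd[OF sm(4), of I\<^sub>1]
  have "smooth_on K X" "smooth_on K Y"
    unfolding tangent_t_def tangent_s_def
    by (intro smooth_on_Pair smooth_on_mult smooth_on_const fs
        smooth_on_linear_comp[OF bounded_linear_cnj])+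
  then show "smooth_on K (\<lambda>p. fst v *\<^sub>R X p + snd v *\<^sub>R Y p)" for v
    by (intro smooth_on_add smooth_on_linear_comp[OF bounded_linear_scaleR_right])
qed auto

text \<open>The set \<open>N\<close> is left open so that the formula serves both the full rectangle
  and the regular parameters.\<close>

lemma dif_F:
  assumes "p \<in> K" "at p within N = at p within K"
  shows "dif N F p = (\<lambda>v. fst v *\<^sub>R X p + snd v *\<^sub>R Y p)"
  using has_derivative_F[OF assms(1)] assms by (intro dif_eqI[OF I1 I2]) auto

lemma herm_dif_F:
  assumes "p \<in> K" "at p within N = at p within K"
  shows "herm (dif N F p u) (dif N F p v) = of_real (r p * inner u v)"
proof -
  have fs: "fst p \<in> I\<^sub>1" "snd p \<in> I\<^sub>2" using assms(1) by auto
  show ?thesis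
    unfolding dif_F[OF assms]
    by (rule herm_combination) (rule herm_tangent[OF T_norm[OF fs(1)] W_norm[OF fs(2)]])+
qed

lemma induced_metric_F:
  assumes "p \<in> K" "at p within N = at p within K"
  shows "induced_metric N F p u v = r p * inner u v"
  unfolding induced_metric_def inner_eq_Re_herm herm_dif_F[OF assms] by (rule Re_complex_of_real)

section \<open>The Lagrangian, angle and soliton properties\<close>

lemma lagrangian_F: "lagrangian_immersion_on M F"
  unfolding lagrangian_immersion_on_def immersion_on_def
proof (intro conjI ballI allI)
  show "smooth_on M F"
    using smooth_on_subset[OF smooth_F M_subset] .
  fix p assume p: "p \<in> M"
  then have pK: "p \<in> K" using M_subset by blast
  show "kaehler_form (dif M F p u) (dif M F p v) = 0" for u v
    unfolding kaehler_form_def herm_dif_F[OF pK at_within_M[OF p]] by simp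
  have lin: "linear (dif M F p)"
    using has_derivative_linear[OF has_derivative_F[OF pK]] dif_F[OF pK at_within_M[OF p]] by simp
  show "inj (dif M F p)"
    unfolding linear_injective_0[OF lin]
  proof (intro allI impI)
    fix v assume "dif M F p v = 0"
    \<comment> \<open>Injectivity follows from positive definiteness of the induced metric at
      regular parameters.\<close>
    then have "r p * inner v v = 0"
      using induced_metric_F[OF pK at_within_M[OF p], of v v] by (simp add: induced_metric_def)
    with r_pos[OF p] show "v = 0" by auto
  qed
qed

lemma lagrangian_angle_F: "lagrangian_angle_map M F (\<lambda>(t, s). \<theta>\<^sub>1 t + \<theta>\<^sub>2 s + pi + \<phi>)"
  unfolding lagrangian_angle_map_def
proof (intro ballI allI)
  fix p u v assume p: "p \<in> M"
  then have pK: "p \<in> K" using M_subset by blast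
  then have fs: "fst p \<in> I\<^sub>1" "snd p \<in> I\<^sub>2" by auto
  have "metric_det M F p = (r p)\<^sup>2"
    unfolding metric_det_def induced_metric_F[OF pK at_within_M[OF p]]
    by (simp add: power2_eq_square)
  then have area: "area_form M F p u v = r p * (fst u * snd v - fst v * snd u)"
    unfolding area_form_def using r_pos[OF p] by simp
  have TW: "T (fst p) = cis (\<theta>\<^sub>1 (fst p))" "W (snd p) = cis (\<theta>\<^sub>2 (snd p))"
    using arg1 arg2 fs T_norm W_norm
    by (simp_all add: continuous_arg_def is_Arg_def cis_conv_exp)
  have "dz1_wedge_dz2 (dif M F p u) (dif M F p v)
      = of_real (fst u * snd v - fst v * snd u) * dz1_wedge_dz2 (X p) (Y p)"
    unfolding dif_F[OF pK at_within_M[OF p]]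
    by (simp add: dz1_wedge_dz2_def scaleR_conv_of_real algebra_simps)
  also have "dz1_wedge_dz2 (X p) (Y p) = - (cis \<phi> * T (fst p) * W (snd p) * of_real (r p))"
    by (rule herm_tangent(5)[OF T_norm[OF fs(1)] W_norm[OF fs(2)]])
  \<comment> \<open>The minus sign is \<open>cis pi\<close>, which accounts for the summand
    \<open>pi\<close> in the angle.\<close>
  also have "\<dots> = cis (\<theta>\<^sub>1 (fst p) + \<theta>\<^sub>2 (snd p) + pi + \<phi>) * of_real (r p)"
    unfolding TW by (simp flip: cis_mult)
  finally show "dz1_wedge_dz2 (dif M F p u) (dif M F p v)
      = exp (\<i> * of_real (case p of (t, s) \<Rightarrow> \<theta>\<^sub>1 t + \<theta>\<^sub>2 s + pi + \<phi>)) * of_real (area_form M F p u v)"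
    unfolding area by (simp add: cis_conv_exp case_prod_beta)
qed

text \<open>Both sides equal \<open>(1 / r p) *\<^sub>R H\<close>, where \<open>H\<close> combines
  the rotated tangent vectors with the two curvatures as coefficients.\<close>

lemma translating_F: "translating_soliton_on M F (1, 0)"
  unfolding translating_soliton_on_def
proof (intro conjI ballI)
  show "immersion_on M F" using lagrangian_F by (simp add: lagrangian_immersion_on_def)
  fix p assume p: "p \<in> M"
  then have pK: "p \<in> K" using M_subset by blast
  then have fs: "fst p \<in> I\<^sub>1" "snd p \<in> I\<^sub>2" by auto
  note norms = T_norm[OF fs(1)] W_norm[OF fs(2)]
  define k where "k = curvature I\<^sub>1 \<alpha> (fst p)"
  define l where "l = curvature I\<^sub>2 \<omega> (snd p)"
  define H where "H = k *\<^sub>R (\<i> * fst (X p), \<i> * snd (X p)) + l *\<^sub>R (\<i> * fst (Y p), \<i> * snd (Y p))"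
  have dF: "dif M F q = (\<lambda>v. fst v *\<^sub>R X q + snd v *\<^sub>R Y q)" if "q \<in> M" for q
    using that M_subset by (intro dif_F at_within_M) auto
  \<comment> \<open>Rotating one argument by \<open>\<i>\<close> turns the metric into the Kaehler
    form, so normality of \<open>H\<close> is the Lagrangian condition.\<close>
  have iJ: "inner (\<i> * fst z, \<i> * snd z) w = - Im (herm z w)" for z w
    by (simp add: herm_def inner_complex_def inner_prod_def algebra_simps)
  have H_orth: "orthogonal H x" if "x \<in> range (dif M F p)" for x
  proof -
    have "X p = dif M F p (1, 0)" "Y p = dif M F p (0, 1)" by (simp_all add: dF[OF p])
    then have "Im (herm (X p) x) = 0" "Im (herm (Y p) x) = 0"
      using that by (auto simp: herm_dif_F[OF pK at_within_M[OF p]] simp del: of_real_mult)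
    then show ?thesis
      unfolding orthogonal_def H_def inner_add_left inner_scaleR_left iJ by simp
  qed
  obtain X' where X': "(X has_derivative X') (at p within K)" "X' (1, 0) =
    (- cis \<phi> * (1 + \<i> * of_real k * cnj (\<alpha> (fst p)) * T (fst p)), \<i> * of_real k * T (fst p) * \<omega> (snd p))"
    using has_derivative_X[OF pK] unfolding k_def by blast
  obtain Y' where Y': "(Y has_derivative Y') (at p within K)" "Y' (0, 1) =
    (cis \<phi> * (1 + \<i> * of_real l * cnj (\<omega> (snd p)) * W (snd p)), \<i> * of_real l * \<alpha> (fst p) * W (snd p))"
    using has_derivative_Y[OF pK] unfolding l_def by blast
  \<comment> \<open>The constant terms \<open>- cis \<phi>\<close> and \<open>cis \<phi>\<close> of
    the two second derivatives cancel.\<close>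
  have "X' (1, 0) + Y' (0, 1) = H"
    by (simp add: X'(2) Y'(2) H_def tangent_t_def tangent_s_def scaleR_conv_of_real algebra_simps)
  moreover have "mean_curvature_vector M F p
      = (1 / r p) *\<^sub>R normal_part (range (dif M F p)) (X' (1, 0) + Y' (0, 1))"
    using X'(1) Y'(1) r_pos[OF p]
    by (intro mean_curvature_vector_conformal[OF I1 I2 M_subset at_within_M[OF p] p dF])
       (auto simp: at_within_M[OF p] inner_eq_Re_herm herm_tangent[OF norms])
  moreover have "normal_part (range (dif M F p)) H = H"
    using H_orth by (intro normal_part_eqI) (auto simp: span_zero)
  ultimately have mean: "mean_curvature_vector M F p = (1 / r p) *\<^sub>R H" by simp
  \<comment> \<open>The scaled \<open>(1, 0)\<close> differs from \<open>H\<close> by a tangent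
    vector; as \<open>H\<close> is normal, division by \<open>r p\<close> gives the normal
    part.\<close>
  have "r p *\<^sub>R (1, 0) - H = inner (1, 0) (X p) *\<^sub>R X p + inner (1, 0) (Y p) *\<^sub>R Y p"
    unfolding H_def k_def l_def
    by (rule e1_decomposition[OF norms curvature_alpha[OF fs(1)] curvature_omega[OF fs(2)]])
  also have "\<dots> = dif M F p (inner (1, 0) (X p), inner (1, 0) (Y p))"
    by (simp add: dF[OF p])
  finally have "r p *\<^sub>R (1, 0) - H \<in> span (range (dif M F p))"
    by (auto intro: span_base)
  then have "(1 / r p) *\<^sub>R (r p *\<^sub>R (1, 0) - H) \<in> span (range (dif M F p))"
    by (rule span_scale)
  moreover have "1 / r p * r p = 1" using r_pos[OF p] by auto
  ultimately have "(1, 0) - (1 / r p) *\<^sub>R H \<in> span (range (dif M F p))"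
    by (simp only: scaleR_right_diff_distrib scaleR_scaleR scaleR_one)
  then have "normal_part (range (dif M F p)) (1, 0) = (1 / r p) *\<^sub>R H"
    using H_orth by (intro normal_part_eqI) (auto simp: orthogonal_def)
  with mean show "mean_curvature_vector M F p = normal_part (range (dif M F p)) (1, 0)" by simp
qed (simp add: prod_eq_iff)

end

theorem proposition2:
  fixes \<phi> t\<^sub>0 s\<^sub>0 :: real and I\<^sub>1 I\<^sub>2 :: "real set"
    and \<alpha> \<omega> :: "real \<Rightarrow> complex" and \<theta>\<^sub>1 \<theta>\<^sub>2 :: "real \<Rightarrow> real"
  assumes "0 \<le> \<phi>" and "\<phi> < pi"
    and "nondegenerate_interval I\<^sub>1" and "nondegenerate_interval I\<^sub>2"
    and "t\<^sub>0 \<in> I\<^sub>1" and "s\<^sub>0 \<in> I\<^sub>2"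
    and "unit_speed_curve I\<^sub>1 \<alpha>" and "unit_speed_curve I\<^sub>2 \<omega>"
    and "\<And>t. t \<in> I\<^sub>1 \<Longrightarrow> curvature_vector I\<^sub>1 \<alpha> t =
           - cos \<phi> *\<^sub>R normal_part {velocity I\<^sub>1 \<alpha> t} (\<alpha> t)
           + sin \<phi> *\<^sub>R normal_part {velocity I\<^sub>1 \<alpha> t} (\<i> * \<alpha> t)"
    and "\<And>s. s \<in> I\<^sub>2 \<Longrightarrow> curvature_vector I\<^sub>2 \<omega> s =
           cos \<phi> *\<^sub>R normal_part {velocity I\<^sub>2 \<omega> s} (\<omega> s)
           - sin \<phi> *\<^sub>R normal_part {velocity I\<^sub>2 \<omega> s} (\<i> * \<omega> s)"
    and "continuous_arg I\<^sub>1 (velocity I\<^sub>1 \<alpha>) \<theta>\<^sub>1" and "continuous_arg I\<^sub>2 (velocity I\<^sub>2 \<omega>) \<theta>\<^sub>2"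
  defines "F \<equiv> curve_product \<phi> I\<^sub>1 I\<^sub>2 \<alpha> \<omega> \<theta>\<^sub>1 \<theta>\<^sub>2 t\<^sub>0 s\<^sub>0"
    and "M \<equiv> regular_parameters I\<^sub>1 I\<^sub>2 \<alpha> \<omega>"
  shows "smooth_on (I\<^sub>1 \<times> I\<^sub>2) F
    \<and> lagrangian_immersion_on M F
    \<and> translating_soliton_on M F (1, 0)
    \<and> (\<forall>t\<in>I\<^sub>1. \<forall>s\<in>I\<^sub>2. \<forall>u v. induced_metric (I\<^sub>1 \<times> I\<^sub>2) F (t, s) u v
          = ((norm (\<alpha> t))\<^sup>2 + (norm (\<omega> s))\<^sup>2) * inner u v)
    \<and> lagrangian_angle_map M F (\<lambda>(t, s). \<theta>\<^sub>1 t + \<theta>\<^sub>2 s + pi + \<phi>)"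
proof -
  interpret S: soliton_curves \<phi> t\<^sub>0 s\<^sub>0 I\<^sub>1 I\<^sub>2 \<alpha> \<omega> \<theta>\<^sub>1 \<theta>\<^sub>2
    by unfold_locales (fact assms)+
  show ?thesis
    unfolding F_def M_def
    \<comment> \<open>The metric formula is taken with \<open>N\<close> the whole rectangle, so it
      also covers parameters where both curves vanish.\<close>
    using S.smooth_F S.lagrangian_F S.translating_F S.lagrangian_angle_F S.induced_metric_F
    by simp
qed

end
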